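(* Let $n\ge4$, and let $f<g$ be consecutive fractions in $F_n^+$. If the smaller denominator belongs to $f$, put $p/q=f$ and $r/s=g$; otherwise put $p/q=1-g$ and $r/s=1-f$ (lowest terms). In either case $p/q<r/s$ and $q<s$. Put $m=\lfloor n/q\rfloor$, $n_0=\max\{mq,s\}$, and let $\boldsymbol\beta=(\beta_0,\ldots,\beta_{m-1})\in[0,1)^m$. Let $\omega=\rho e^{i\vartheta}$, with $0<\rho<1$, be a root of the polynomial $$t^{n_0-mq}\prod_{j=0}^{m-1}(t^q-\beta_j)-t^{n_0-s}\prod_{j=0}^{m-1}(1-\beta_j)$$ in $t$, with $$\frac pq<\frac{\vartheta}{2\pi}<\frac rs.$$ Define $$A=q\vartheta-2\pi p,\qquad B=\frac{2\pi r-s\vartheta}{m},\qquad\theta=\min\{\vartheta,2\pi-\vartheta\},$$ and use arguments in $(0,\pi)$ to set $$M=\operatorname{Arg}(\omega^q-1),\qquad u_j=\operatorname{Arg}(\omega^q-\beta_j)\quad(0\le j<m).$$ These satisfy $A\le u_j<M$. Assume that, as an equality of real numbers, $$(s-mq)\vartheta+\sum_{j=0}^{m-1}u_j=2\pi(r-mp).$$ Then $$\rho\le K_n(\theta),$$ and $\rho=K_n(\theta)$ if and only if $\beta_0=\cdots=\beta_{m-1}$. In that case, their common value is uniquely determined by $$\beta_*=\frac{K_n(\theta)^q\sin B}{\sin(A+B)}.$$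
   Context: $F_n$ is the increasing list of reduced fractions in $[0,1]$ with denominator at most $n$; $F_n^+=F_n\cap[0,1/2]$. The polynomial in the claim is the characteristic polynomial of a row-stochastic matrix of order $n_0$ with parameters $\boldsymbol\beta$. For the interval data and angle in the claim one has $A,B>0$, $A+B<\pi$, and $K_n(\theta)$ is the unique solution $R\in(0,1)$ of $$R^{s/m}\sin A+R^q\sin B=\sin(A+B).$$ (It also equals the maximal modulus of an eigenvalue with argument $\theta$ of a real row-stochastic $n\times n$ matrix.) $\operatorname{Arg}$ is the principal argument. *)

theory Defs
  imports "HOL-Analysis.Analysis" "HOL-Computational_Algebra.Polynomial"
begin

text \<open>Numerator and denominator in lowest terms. Numerators are only taken of
  nonnegative rationals, so the truncation by \<open>nat\<close> is harmless.\<close>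

definition numer :: "rat \<Rightarrow> nat" where
  "numer x = nat (fst (quotient_of x))"

definition denom :: "rat \<Rightarrow> nat" where
  "denom x = nat (snd (quotient_of x))"

definition farey :: "nat \<Rightarrow> rat set" where
  "farey n = {x. 0 \<le> x \<and> x \<le> 1 \<and> denom x \<le> n}"

definition farey_half :: "nat \<Rightarrow> rat set" where
  "farey_half n = farey n \<inter> {0..1/2}"

definition consecutive_in :: "rat set \<Rightarrow> rat \<Rightarrow> rat \<Rightarrow> bool" where
  "consecutive_in F f g \<longleftrightarrow> f \<in> F \<and> g \<in> F \<and> f < g \<and> \<not> (\<exists>h\<in>F. f < h \<and> h < g)"

text \<open>The fractions \<open>p/q\<close> and \<open>r/s\<close> attached to the Farey interval \<open>(f, g)\<close>: the interval
  is reflected by \<open>x \<mapsto> 1 - x\<close> when the smaller denominator belongs to \<open>g\<close>.\<close>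

definition lower_frac :: "rat \<Rightarrow> rat \<Rightarrow> rat" where
  "lower_frac f g = (if denom f < denom g then f else 1 - g)"

definition upper_frac :: "rat \<Rightarrow> rat \<Rightarrow> rat" where
  "upper_frac f g = (if denom f < denom g then g else 1 - f)"

definition angle_A :: "nat \<Rightarrow> nat \<Rightarrow> real \<Rightarrow> real" where
  "angle_A p q \<phi> = real q * \<phi> - 2 * pi * real p"

definition angle_B :: "nat \<Rightarrow> nat \<Rightarrow> nat \<Rightarrow> real \<Rightarrow> real" where
  "angle_B r s m \<phi> = (2 * pi * real r - real s * \<phi>) / real m"

text \<open>\<open>karp_radius n \<theta>\<close> is \<open>K\<^sub>n(\<theta>)\<close>, for \<open>\<theta> / (2 \<pi>)\<close> in \<open>(0, 1/2)\<close> and not a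
  Farey fraction. Then \<open>f, g\<close> are determined by \<open>\<theta>\<close>, and \<open>\<phi>\<close> is the representative of
  \<open>\<plusminus>\<theta>\<close> for which \<open>\<phi> / (2 \<pi>)\<close> lies between \<open>p/q\<close> and \<open>r/s\<close>.\<close>

definition karp_radius :: "nat \<Rightarrow> real \<Rightarrow> real" where
  "karp_radius n \<theta> = (THE R. 0 < R \<and> R < 1 \<and>
     (\<exists>f g. consecutive_in (farey_half n) f g \<and>
        of_rat f < \<theta> / (2 * pi) \<and> \<theta> / (2 * pi) < of_rat g \<and>
        (let p = numer (lower_frac f g); q = denom (lower_frac f g);
             r = numer (upper_frac f g); s = denom (upper_frac f g);
             m = n div q;
             \<phi> = (if denom f < denom g then \<theta> else 2 * pi - \<theta>);
             A = angle_A p q \<phi>; B = angle_B r s m \<phi>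
         in R powr (real s / real m) * sin A + R ^ q * sin B = sin (A + B))))"

definition ito_poly :: "nat \<Rightarrow> nat \<Rightarrow> nat \<Rightarrow> nat \<Rightarrow> (nat \<Rightarrow> real) \<Rightarrow> complex poly" where
  "ito_poly n0 q s m \<beta> =
     monom 1 (n0 - m * q) * (\<Prod>j<m. (monom 1 q - [:complex_of_real (\<beta> j):]))
     - smult (\<Prod>j<m. complex_of_real (1 - \<beta> j)) (monom 1 (n0 - s))"

end

(*
  Put z = \<omega>^q = x e^{iA} with x = \<rho>^q and N = |z - 1|. The law of sines in the triangle with
  vertices 0, \<beta>_j, z gives |z - \<beta>_j| sin u_j = x sin A, and likewise
  (1 - \<beta>_j) sin u_j = N sin (M - u_j). The angle equation says that the u_j have mean A + B.
  Hence the modulus of the root equation becomes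
    (\<rho>^{s/m} sin A)^m = \<Prod>_j N sin (M - u_j),
  and strict log-concavity of the sine bounds the right-hand side by (N sin (M - A - B))^m,
  where N sin (M - A - B) = sin (A + B) - \<rho>^q sin B. So \<rho> satisfies the equation of K_n(\<theta>)
  with \<le>, and with equality exactly when all u_j, equivalently all \<beta>_j, coincide.
*)

theory Submission
  imports Defs
begin

section \<open>Lowest terms and neighbouring Farey fractions\<close>

lemma of_rat_eq_numer_denom:
  assumes "0 \<le> x"
  shows "x = of_nat (numer x) / of_nat (denom x)"
    and "denom x > 0" and "coprime (numer x) (denom x)"
proof -
  obtain a b where ab: "quotient_of x = (a, b)" by fastforce
  have b: "b > 0" and c: "coprime a b" and x: "x = of_int a / of_int b"
    using ab quotient_of_denom_pos quotient_of_coprime quotient_of_div by blast+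
  have a: "a \<ge> 0"
    using assms b unfolding x by (simp add: zero_le_divide_iff)
  have n: "numer x = nat a" and d: "denom x = nat b"
    using ab by (simp_all add: numer_def denom_def)
  show "denom x > 0" using b d by simp
  show "coprime (numer x) (denom x)"
    using c a b n d by (simp add: coprime_int_iff [symmetric])
  show "x = of_nat (numer x) / of_nat (denom x)"
    using x a b n d by simp
qed

lemma numer_denom_divide:
  assumes "b > 0" "coprime a b"
  shows "numer (of_nat a / of_nat b) = a" "denom (of_nat a / of_nat b) = b"
proof -
  have "quotient_of (Fract (int a) (int b)) = (int a, int b)"
    using assms by (simp add: quotient_of_Fract Rat.normalize_stable)
  then have "quotient_of (of_nat a / of_nat b) = (int a, int b)"
    by (simp add: Fract_of_int_quotient)
  then show "numer (of_nat a / of_nat b) = a" "denom (of_nat a / of_nat b) = b"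
    by (simp_all add: numer_def denom_def)
qed

lemma numer_denom_one_minus:
  assumes "0 \<le> x" "x \<le> 1"
  shows "numer (1 - x) = denom x - numer x" "denom (1 - x) = denom x" "numer x \<le> denom x"
proof -
  let ?a = "numer x" and ?b = "denom x"
  note x = of_rat_eq_numer_denom[OF assms(1)]
  have "(of_nat ?a :: rat) \<le> of_nat ?b"
    using assms(2) x(1,2) by (metis divide_le_eq_1_pos of_nat_0_less_iff)
  then show le: "?a \<le> ?b" by simp
  have "1 - x = of_nat (?b - ?a) / of_nat ?b"
    using x(2) le by (subst x(1)) (simp add: of_nat_diff field_simps)
  moreover have "coprime (?b - ?a) ?b"
    using x(3) le by (metis coprime_imp_coprime dvd_diff_nat diff_diff_cancel)
  ultimately show "numer (1 - x) = ?b - ?a" "denom (1 - x) = ?b"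
    using numer_denom_divide[OF x(2)] by simp_all
qed

lemma farey_half_bounds:
  assumes "consecutive_in (farey_half n) f g"
  shows "0 \<le> f" "f < g" "g \<le> 1/2" "denom f \<le> n" "denom g \<le> n"
  using assms unfolding consecutive_in_def farey_half_def farey_def by fastforce+

text \<open>The competitor \<open>x / y\<close> solves \<open>b x - a y = 1\<close> with \<open>y\<close> as large as possible:
  it lies above \<open>f\<close>, and if it lay above \<open>g\<close> then \<open>denom g\<close> would exceed \<open>n\<close>.\<close>

lemma farey_half_neighbours:
  assumes "consecutive_in (farey_half n) f g"
  shows "denom f * numer g = numer f * denom g + 1" "n < denom f + denom g"
proof -
  have f0: "0 \<le> f" and g0: "0 \<le> g" and g2: "g \<le> 1/2" and fg: "f < g"
    and fn: "denom f \<le> n" and gn: "denom g \<le> n"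
    using farey_half_bounds[OF assms] by auto
  have no: "\<And>h. 0 \<le> h \<Longrightarrow> h \<le> 1/2 \<Longrightarrow> denom h \<le> n \<Longrightarrow> \<not> (f < h \<and> h < g)"
    using assms unfolding consecutive_in_def farey_half_def farey_def by fastforce
  define a b c d where "a = int (numer f)" and "b = int (denom f)"
    and "c = int (numer g)" and "d = int (denom g)"
  have b: "b > 0" and d: "d > 0" and a0: "a \<ge> 0" and ab: "coprime a b" and cd: "coprime c d"
    and f: "f = of_int a / of_int b" and g: "g = of_int c / of_int d"
    and bn: "b \<le> n" and dn: "d \<le> n"
    using of_rat_eq_numer_denom[OF f0] of_rat_eq_numer_denom[OF g0] fn gn
    by (simp_all add: a_def b_def c_def d_def coprime_int_iff)
  have det: "a * d < c * b"
  proof -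
    have "(of_int (a * d) :: rat) < of_int (c * b)"
      using fg b d unfolding f g by (simp add: field_simps)
    then show ?thesis by (simp only: of_int_less_iff)
  qed
  obtain x0 y0 where xy0: "b * x0 - a * y0 = 1"
  proof -
    obtain u v where "u * a + v * b = 1"
      using ab bezout_int[of a b] by (auto simp: coprime_iff_gcd_eq_1)
    then have "b * v - a * (- u) = 1" by (simp add: algebra_simps)
    then show ?thesis using that by blast
  qed
  \<comment> \<open>All solutions of \<open>b * x - a * y = 1\<close> arise from one by adding
    \<open>t * a\<close> to \<open>x0\<close> and \<open>t * b\<close> to \<open>y0\<close>. This
    \<open>t\<close> moves \<open>y\<close> into the window from \<open>n - b + 1\<close> to
    \<open>n\<close>.\<close>
  define t where "t = (int n - y0) div b"
  define x y where "x = x0 + t * a" and "y = y0 + t * b"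
  have xy: "b * x - a * y = 1"
    using xy0 by (simp add: x_def y_def algebra_simps)
  have "t * b + (int n - y0) mod b = int n - y0"
    unfolding t_def by (rule div_mult_mod_eq)
  then have "y = int n - (int n - y0) mod b"
    by (simp add: y_def)
  moreover have "0 \<le> (int n - y0) mod b" "(int n - y0) mod b < b" using b by auto
  ultimately have yn: "y \<le> n" and yb: "n < y + b" by auto
  have y: "y > 0" using bn yb by simp
  have "b * x > 0" using xy a0 y by (smt (verit) mult_nonneg_nonneg)
  then have x: "x > 0" using b by (simp add: zero_less_mult_iff)
  have cop: "coprime x y"
  proof (rule coprimeI)
    fix e assume "e dvd x" "e dvd y"
    then have "e dvd b * x - a * y" by (intro dvd_diff dvd_mult)
    then show "e dvd 1" using xy by simp
  qed
  define h :: rat where "h = of_int x / of_int y"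
  have h: "numer h = nat x" "denom h = nat y"
    using numer_denom_divide[of "nat y" "nat x"] cop x y
    by (simp_all add: h_def coprime_int_iff [symmetric])
  have fh: "f < h"
  proof -
    have "(of_int (a * y) :: rat) < of_int (b * x)"
      using xy by (simp only: of_int_less_iff)
    then show ?thesis using b y unfolding f h_def by (simp add: field_simps)
  qed
  \<comment> \<open>Since \<open>y\<close> is at most \<open>n\<close> and \<open>g\<close> at most
    1/2, \<open>h\<close> would be a member of \<open>farey_half n\<close> strictly between
    \<open>f\<close> and \<open>g\<close>.\<close>
  have "\<not> h < g" using no[of h] fh f0 g2 h yn y by (auto simp: nat_le_iff)
  moreover have "\<not> g < h"
  proof
    assume "g < h"
    then have "(of_int (c * y) :: rat) < of_int (x * d)"
      using y d unfolding g h_def by (simp add: field_simps)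
    then have lt: "c * y < x * d" by (simp only: of_int_less_iff)
    \<comment> \<open>Both brackets on the left are positive integers and the right side is
      \<open>d\<close>, so \<open>d\<close> is at least \<open>b + y\<close>, which exceeds
      \<open>n\<close>.\<close>
    have "b * (x * d - c * y) + y * (c * b - a * d) = d * (b * x - a * y)"
      by (simp add: algebra_simps)
    also have "\<dots> = d" using xy by simp
    finally have *: "b * (x * d - c * y) + y * (c * b - a * d) = d" .
    have "b \<le> b * (x * d - c * y)" "y \<le> y * (c * b - a * d)"
      using lt det b y by simp_all
    then show False using * dn yb by linarith
  qed
  ultimately have "g = h" by simp
  then have "c = x" "d = y" using h x y by (simp_all add: c_def d_def)
  then have "b * c - a * d = 1" "n < b + d" using xy yb by simp_all
  then show "denom f * numer g = numer f * denom g + 1" "n < denom f + denom g"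
    unfolding a_def b_def c_def d_def by (simp_all add: algebra_simps flip: of_nat_mult of_nat_add)
qed

text \<open>A common denominator would divide the determinant 1, hence be 1, and the denominator sum
  2 would have to exceed \<open>n\<close>. This makes the \<open>else\<close> branch of
  \<open>lower_frac\<close> and \<open>upper_frac\<close> the case
  \<open>denom g < denom f\<close>.\<close>

lemma farey_half_denom_neq:
  assumes "n \<ge> 4" "consecutive_in (farey_half n) f g"
  shows "denom f \<noteq> denom g"
proof
  assume eq: "denom f = denom g"
  have "denom f * numer g = numer f * denom f + 1"
    using farey_half_neighbours(1)[OF assms(2)] eq by simp
  then have "denom f dvd 1"
    by (metis dvd_add_right_iff dvd_triv_left dvd_triv_right)
  then show False using farey_half_neighbours(2)[OF assms(2)] eq assms(1) by simp
qed

text \<open>Reflection in 1/2 swaps the ends of the interval and preserves denominators and the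
  determinant, so both orientations inherit the neighbour relations of \<open>f\<close> and
  \<open>g\<close>.\<close>

lemma lower_upper_frac:
  assumes n: "n \<ge> 4" and fg: "consecutive_in (farey_half n) f g"
    and "p = numer (lower_frac f g)" "q = denom (lower_frac f g)"
    and "r = numer (upper_frac f g)" "s = denom (upper_frac f g)"
  shows "q * r = p * s + 1" "q < s" "n < q + s" "s \<le> n" "0 < q"
    "of_rat (lower_frac f g) = real p / real q" "of_rat (upper_frac f g) = real r / real s"
proof -
  note bds = farey_half_bounds[OF fg] and nb = farey_half_neighbours[OF fg]
  have 01: "0 \<le> lower_frac f g" "0 \<le> upper_frac f g"
    using bds by (auto simp: lower_frac_def upper_frac_def)
  have g0: "0 \<le> g" using bds by simp
  note l = of_rat_eq_numer_denom[OF 01(1)] and u = of_rat_eq_numer_denom[OF 01(2)]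
  have "of_rat (lower_frac f g) = (of_rat (of_nat p / of_nat q) :: real)"
    "of_rat (upper_frac f g) = (of_rat (of_nat r / of_nat s) :: real)"
    using l(1) u(1) assms by simp_all
  then show "of_rat (lower_frac f g) = real p / real q" "of_rat (upper_frac f g) = real r / real s"
    by (simp_all add: of_rat_divide)
  show "0 < q" using l assms by simp
  have "q * r = p * s + 1 \<and> q < s \<and> n < q + s \<and> s \<le> n"
  proof (cases "denom f < denom g")
    case True
    then show ?thesis using nb bds assms by (simp add: lower_frac_def upper_frac_def)
  next
    case False
    then have lt: "denom g < denom f" using farey_half_denom_neq[OF n fg] by simp
    have F: "numer (1 - f) = denom f - numer f" "denom (1 - f) = denom f" "numer f \<le> denom f"
      and G: "numer (1 - g) = denom g - numer g" "denom (1 - g) = denom g" "numer g \<le> denom g"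
      using numer_denom_one_minus bds g0 by force+
    have "denom g * (denom f - numer f) = (denom g - numer g) * denom f + 1"
    proof -
      \<comment> \<open>Naming the differences removes truncated subtraction from the
        identity.\<close>
      obtain c d where "denom f = numer f + c" "denom g = numer g + d"
        using F(3) G(3) by (auto simp: le_iff_add)
      then show ?thesis using nb(1) by (simp add: algebra_simps)
    qed
    then show ?thesis
      using lt nb bds F G False assms by (simp add: lower_frac_def upper_frac_def)
  qed
  then show "q * r = p * s + 1" "q < s" "n < q + s" "s \<le> n" by auto
qed

section \<open>Strict log-concavity of the sine\<close>

text \<open>The left side divided by the right side equals 1 at 0, and its derivative is a negative
  multiple of \<open>sin t\<close>, so it decreases strictly up to pi.\<close>

lemma cos_add_mult_sin_less_exp:
  fixes k d :: real
  assumes "0 < d" "d < pi"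
  shows "cos d + k * sin d < exp (k * d)"
proof -
  let ?G = "\<lambda>t. exp (- (k * t)) * (cos t + k * sin t)"
  have "?G d < ?G 0"
  proof (rule DERIV_neg_imp_decreasing_open[OF assms(1)])
    fix t assume t: "0 < t" "t < d"
    have "(?G has_real_derivative - ((1 + k\<^sup>2) * exp (- (k * t)) * sin t)) (at t)"
      by (auto intro!: derivative_eq_intros simp: algebra_simps power2_eq_square)
    moreover have "(1 + k\<^sup>2) * exp (- (k * t)) * sin t > 0"
      using t assms by (intro mult_pos_pos sin_gt_zero) (auto simp: add_pos_nonneg)
    ultimately show "\<exists>y. (?G has_real_derivative y) (at t) \<and> y < 0" by force
  qed (auto intro!: continuous_intros)
  then have "exp (k * d) * ?G d < exp (k * d)" by simp
  then show ?thesis by (simp add: mult.assoc [symmetric] mult_exp_exp)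
qed

text \<open>The graph of log sin lies below its tangent at \<open>b\<close>, whose slope is
  \<open>cot b\<close>, and touches it only there. The exponentiated form avoids logarithms.\<close>

lemma sin_le_tangent_exp:
  fixes a b :: real
  assumes "0 < a" "a < pi" "0 < b" "b < pi"
  shows "a \<noteq> b \<Longrightarrow> sin a < sin b * exp (cot b * (a - b))"
    and "sin a \<le> sin b * exp (cot b * (a - b))"
proof -
  have sb: "sin b > 0" using assms sin_gt_zero by blast
  have eq: "sin a = sin b * (cos (a - b) + cot b * sin (a - b))"
  proof -
    have "sin a = sin (b + (a - b))" by simp
    then show ?thesis using sb unfolding sin_add cot_def by (simp add: field_simps)
  qed
  show lt: "sin a < sin b * exp (cot b * (a - b))" if "a \<noteq> b"
  proof -
    have "cos (a - b) + cot b * sin (a - b) < exp (cot b * (a - b))"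
    proof (cases "a > b")
      case True
      then show ?thesis using assms by (intro cos_add_mult_sin_less_exp) auto
    next
      case False
      \<comment> \<open>The exponential bound needs a positive displacement, so both displacement
        and slope change sign; their product does not.\<close>
      then have "cos (b - a) + (- cot b) * sin (b - a) < exp ((- cot b) * (b - a))"
        using that assms by (intro cos_add_mult_sin_less_exp) auto
      moreover have "cos (b - a) = cos (a - b)" by (metis cos_minus minus_diff_eq)
      moreover have "sin (b - a) = - sin (a - b)" by (metis sin_minus minus_diff_eq)
      ultimately show ?thesis by (simp add: algebra_simps)
    qed
    then show ?thesis using eq sb by simp
  qed
  show "sin a \<le> sin b * exp (cot b * (a - b))"
    using lt by (cases "a = b") auto
qed

text \<open>Jensen's inequality for log sin: when the tangent bounds at the mean \<open>b\<close>
  are multiplied, their exponents sum to zero and only the power of \<open>sin b\<close>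
  remains.\<close>

lemma prod_sin_le:
  fixes a :: "'i \<Rightarrow> real"
  assumes fin: "finite I" and a: "\<And>i. i \<in> I \<Longrightarrow> 0 < a i \<and> a i < pi"
    and b: "0 < b" "b < pi" and mean: "(\<Sum>i\<in>I. a i) = real (card I) * b"
  shows "(\<Prod>i\<in>I. sin (a i)) \<le> sin b ^ card I"
    and "(\<Prod>i\<in>I. sin (a i)) = sin b ^ card I \<longleftrightarrow> (\<forall>i\<in>I. a i = b)"
proof -
  let ?t = "\<lambda>i. sin b * exp (cot b * (a i - b))"
  have "(\<Prod>i\<in>I. exp (cot b * (a i - b))) = exp (\<Sum>i\<in>I. cot b * (a i - b))"
    using fin by (simp add: exp_sum)
  also have "(\<Sum>i\<in>I. cot b * (a i - b)) = 0"
    by (simp add: sum_subtractf mean flip: sum_distrib_left)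
  finally have t: "(\<Prod>i\<in>I. ?t i) = sin b ^ card I"
    by (simp add: prod.distrib)
  have pos: "0 < sin (a i)" if "i \<in> I" for i using a that sin_gt_zero by blast
  have le: "sin (a i) \<le> ?t i" if "i \<in> I" for i using sin_le_tangent_exp(2) a that b by blast
  show "(\<Prod>i\<in>I. sin (a i)) \<le> sin b ^ card I"
    unfolding t[symmetric] using pos le by (intro prod_mono) (auto intro: less_imp_le)
  show "(\<Prod>i\<in>I. sin (a i)) = sin b ^ card I \<longleftrightarrow> (\<forall>i\<in>I. a i = b)"
  proof
    assume eq: "(\<Prod>i\<in>I. sin (a i)) = sin b ^ card I"
    show "\<forall>i\<in>I. a i = b"
    proof (rule ccontr)
      assume "\<not> ?thesis"
      then obtain i where i: "i \<in> I" "a i \<noteq> b" by blast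
      have lt: "sin (a i) < ?t i" using sin_le_tangent_exp(1) a i b by blast
      \<comment> \<open>One strict tangent bound suffices, because the remaining factors are
        positive.\<close>
      have "(\<Prod>j\<in>I. sin (a j)) = sin (a i) * (\<Prod>j\<in>I - {i}. sin (a j))"
        using fin i by (simp add: prod.remove)
      also have "\<dots> < ?t i * (\<Prod>j\<in>I - {i}. sin (a j))"
        using lt pos by (intro mult_strict_right_mono prod_pos) auto
      also have "\<dots> \<le> ?t i * (\<Prod>j\<in>I - {i}. ?t j)"
        using pos le lt i(1) b
        by (intro mult_left_mono prod_mono) (force intro: less_imp_le sin_gt_zero)+
      also have "\<dots> = (\<Prod>j\<in>I. ?t j)" using fin i by (simp add: prod.remove)
      finally show False using eq t by simp
    qed
  qed simp
qed

section \<open>Trigonometry of the triangle with vertices 0, b and z\<close>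

lemma Arg_upper:
  assumes "0 < Im w"
  shows "0 < Arg w" "Arg w < pi" "Re w = cmod w * cos (Arg w)" "Im w = cmod w * sin (Arg w)"
proof -
  show "0 < Arg w" "Arg w < pi" using assms Arg_lt_pi by auto
  have "w = rcis (cmod w) (Arg w)" by (simp add: rcis_cmod_Arg)
  then show "Re w = cmod w * cos (Arg w)" "Im w = cmod w * sin (Arg w)"
    by (metis Re_rcis, metis Im_rcis)
qed

text \<open>A real shift leaves the imaginary part \<open>x * sin A\<close> unchanged. The relation
  for \<open>b\<close> is the law of sines, with side \<open>b\<close> opposite the angle
  \<open>u - A\<close>. It is needed for each beta_j and, with \<open>b = 1\<close>, for
  \<open>M\<close>.\<close>

lemma Arg_shift:
  fixes x A b :: real
  assumes x: "0 < x" and A: "0 < A" "A < pi"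
    and u: "u = Arg (complex_of_real x * cis A - complex_of_real b)"
  shows "0 < u" "u < pi" "b * sin u = x * sin (u - A)"
    "cmod (complex_of_real x * cis A - complex_of_real b) * sin u = x * sin A"
proof -
  let ?w = "complex_of_real x * cis A - complex_of_real b"
  have sA: "sin A > 0" using A sin_gt_zero by blast
  have im: "Im ?w = x * sin A" and re: "Re ?w = x * cos A - b" by simp_all
  then have "Im ?w > 0" using sA x by simp
  note w = Arg_upper[OF this, folded u]
  show "0 < u" "u < pi" by (fact w)+
  show "cmod ?w * sin u = x * sin A" using w(4) im by simp
  have 1: "x * cos A - b = cmod ?w * cos u" and 2: "x * sin A = cmod ?w * sin u"
    using w(3,4) im re by simp_all
  have "b * sin u - x * sin (u - A) = x * sin A * cos u - (x * cos A - b) * sin u"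
    by (simp add: sin_diff algebra_simps)
  also have "\<dots> = 0" unfolding 1 2 by (simp add: algebra_simps)
  finally show "b * sin u = x * sin (u - A)" by simp
qed

text \<open>Both sides are the imaginary part of (z - 1) e^(-iv), where z = x e^(iA). The free
  \<open>v\<close> is later set to u_j and to \<open>A + B\<close>.\<close>

lemma Arg_shift_one:
  fixes x A b :: real
  assumes x: "0 < x" and A: "0 < A" "A < pi"
    and M: "M = Arg (complex_of_real x * cis A - 1)"
  shows "sin v - x * sin (v - A) = cmod (complex_of_real x * cis A - 1) * sin (M - v)"
proof -
  let ?w = "complex_of_real x * cis A - 1"
  have sA: "sin A > 0" using A sin_gt_zero by blast
  have im: "Im ?w = x * sin A" and re: "Re ?w = x * cos A - 1" by simp_all
  then have "Im ?w > 0" using sA x by simp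
  note w = Arg_upper[OF this, folded M]
  have "cmod ?w * sin (M - v) = (cmod ?w * sin M) * cos v - (cmod ?w * cos M) * sin v"
    by (simp add: sin_diff algebra_simps)
  also have "\<dots> = x * sin A * cos v - (x * cos A - 1) * sin v"
    using w(3,4) im re by simp
  finally show ?thesis by (simp add: sin_diff algebra_simps)
qed

section \<open>The equation that determines K_n(theta)\<close>

text \<open>The left side of the equation for K_n(theta), with \<open>e\<close> in the role of
  s/m.\<close>

definition karp_fun :: "real \<Rightarrow> nat \<Rightarrow> real \<Rightarrow> real \<Rightarrow> real \<Rightarrow> real" where
  "karp_fun e q A B R = R powr e * sin A + R ^ q * sin B"

lemma karp_fun_strict_mono:
  assumes "0 < e" "0 < A" "A < pi" "0 < B" "B < pi" "0 < R" "R < R'"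
  shows "karp_fun e q A B R < karp_fun e q A B R'"
  unfolding karp_fun_def using assms
  by (intro add_less_le_mono mult_strict_right_mono mult_right_mono powr_less_mono2 power_mono)
    (auto intro: sin_gt_zero less_imp_le)

text \<open>The function is 0 at 0, because \<open>0 powr e = 0\<close> and \<open>q\<close> is
  positive, and at 1 it is \<open>sin A + sin B\<close>, which exceeds \<open>sin (A + B)\<close>.
  The intermediate value theorem gives a solution and monotonicity its uniqueness.\<close>

lemma karp_fun_ex1:
  assumes e: "0 < e" and q: "0 < q" and AB: "0 < A" "0 < B" "A + B < pi"
  shows "\<exists>!R. 0 < R \<and> R < 1 \<and> karp_fun e q A B R = sin (A + B)"
proof -
  have s: "sin A > 0" "sin B > 0" "sin (A + B) > 0" using AB by (auto intro!: sin_gt_zero)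
  have "cos A < 1" "cos B < 1"
    using AB cos_monotone_0_pi[of 0 A] cos_monotone_0_pi[of 0 B] by auto
  then have "sin A * cos B < sin A * 1" "cos A * sin B < 1 * sin B"
    using s by (simp_all only: mult_less_cancel_left_pos mult_less_cancel_right_pos)
  then have one: "sin (A + B) < sin A + sin B"
    unfolding sin_add by simp
  have "continuous_on {0..1} (karp_fun e q A B)"
    unfolding karp_fun_def using e by (intro continuous_intros continuous_on_powr') auto
  then obtain R where R: "0 \<le> R" "R \<le> 1" "karp_fun e q A B R = sin (A + B)"
    using IVT'[of "karp_fun e q A B" 0 "sin (A + B)" 1] s one q by (auto simp: karp_fun_def power_0_left)
  have "R \<noteq> 0" "R \<noteq> 1" using R(3) s one q by (auto simp: karp_fun_def power_0_left)
  then have R01: "0 < R" "R < 1" using R by auto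
  show ?thesis
  proof (rule ex1I[of _ R])
    show "0 < R \<and> R < 1 \<and> karp_fun e q A B R = sin (A + B)" using R01 R by simp
  next
    fix R' assume R': "0 < R' \<and> R' < 1 \<and> karp_fun e q A B R' = sin (A + B)"
    have AB': "A < pi" "B < pi" using AB by auto
    show "R' = R"
      using karp_fun_strict_mono[OF e AB(1) AB'(1) AB(2) AB'(2), of R R' q]
        karp_fun_strict_mono[OF e AB(1) AB'(1) AB(2) AB'(2), of R' R q] R01 R R'
      by (cases R R' rule: linorder_cases) auto
  qed
qed

text \<open>Straddling the same \<open>t\<close> forces \<open>f < g'\<close> and
  \<open>f' < g\<close>; if two left or two right ends differed, one of them would lie inside the
  other gap.\<close>

lemma consecutive_in_unique:
  fixes t :: real
  assumes "consecutive_in F f g" "of_rat f < t" "t < of_rat g"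
    and "consecutive_in F f' g'" "of_rat f' < t" "t < of_rat g'"
  shows "f' = f \<and> g' = g"
proof -
  have "f < g'" "f' < g" using assms by (meson less_trans of_rat_less)+
  then show ?thesis using assms(1,4) unfolding consecutive_in_def by (metis linorder_neqE)
qed

text \<open>The Farey pair around \<open>\<theta> / (2 * pi)\<close> is unique, so the existential
  in \<open>karp_radius\<close> collapses to the given pair and one equation in \<open>R\<close>
  remains.\<close>

lemma karp_radius_eq:
  assumes fg: "consecutive_in (farey_half n) f g"
    and \<theta>: "of_rat f < \<theta> / (2 * pi)" "\<theta> / (2 * pi) < of_rat g"
    and "p = numer (lower_frac f g)" "q = denom (lower_frac f g)"
    and "r = numer (upper_frac f g)" "s = denom (upper_frac f g)"
    and "m = n div q" and \<phi>: "\<phi> = (if denom f < denom g then \<theta> else 2 * pi - \<theta>)"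
    and "A = angle_A p q \<phi>" "B = angle_B r s m \<phi>"
  shows "karp_radius n \<theta> =
    (THE R. 0 < R \<and> R < 1 \<and> karp_fun (real s / real m) q A B R = sin (A + B))"
  unfolding karp_radius_def
proof (rule arg_cong[where f = The], rule ext, safe, goal_cases)
  case (1 R f' g')
  have "f' = f \<and> g' = g" using consecutive_in_unique[OF fg \<theta>] 1 by blast
  then show ?case using 1 assms by (simp add: karp_fun_def Let_def)
next
  case (2 R)
  then show ?case using assms
    by (intro exI[of _ f] exI[of _ g]) (simp add: karp_fun_def Let_def)
qed

lemma poly_ito_poly:
  "poly (ito_poly n0 q s m \<beta>) w = w ^ (n0 - m * q) * (\<Prod>j<m. (w ^ q - complex_of_real (\<beta> j)))
     - w ^ (n0 - s) * (\<Prod>j<m. complex_of_real (1 - \<beta> j))"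
  unfolding ito_poly_def by (simp add: poly_prod poly_monom)

section \<open>Bounding rho, the case of equality, and the common value of the parameters\<close>

theorem corollaryB2:
  fixes n p q r s m n0 :: nat and f g :: rat and \<beta> u :: "nat \<Rightarrow> real"
    and \<omega> :: complex and \<rho> \<phi> \<theta> A B M :: real
  assumes "n \<ge> 4"
    and "consecutive_in (farey_half n) f g"
    and "p = numer (lower_frac f g)" and "q = denom (lower_frac f g)"
    and "r = numer (upper_frac f g)" and "s = denom (upper_frac f g)"
    and "m = n div q" and "n0 = max (m * q) s"
    and "\<forall>j<m. 0 \<le> \<beta> j \<and> \<beta> j < 1"
    and "0 < \<rho>" and "\<rho> < 1"
    and "\<omega> = complex_of_real \<rho> * exp (\<i> * complex_of_real \<phi>)"
    and "poly (ito_poly n0 q s m \<beta>) \<omega> = 0"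
    and "real p / real q < \<phi> / (2 * pi)" and "\<phi> / (2 * pi) < real r / real s"
    and "A = angle_A p q \<phi>" and "B = angle_B r s m \<phi>"
    and "\<theta> = min \<phi> (2 * pi - \<phi>)"
    and "M = Arg (\<omega> ^ q - 1)"
    and "\<forall>j<m. u j = Arg (\<omega> ^ q - complex_of_real (\<beta> j))"
    and "(real s - real m * real q) * \<phi> + (\<Sum>j<m. u j) = 2 * pi * (real r - real m * real p)"
  shows "real p / real q < real r / real s \<and> q < s
    \<and> 0 < M \<and> M < pi \<and> (\<forall>j<m. 0 < u j \<and> u j < pi \<and> A \<le> u j \<and> u j < M)
    \<and> \<rho> \<le> karp_radius n \<theta>
    \<and> (\<rho> = karp_radius n \<theta> \<longleftrightarrow> (\<forall>i<m. \<forall>j<m. \<beta> i = \<beta> j))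
    \<and> ((\<forall>i<m. \<forall>j<m. \<beta> i = \<beta> j) \<longrightarrow>
         (\<forall>j<m. \<beta> j = karp_radius n \<theta> ^ q * sin B / sin (A + B)))"
proof -
  note fg = assms(2)
  note F = lower_upper_frac[OF assms(1,2) assms(3-6)]
  have q: "q > 0" and s: "s > 0" and qs: "q < s" and s3: "s \<ge> 3"
    using F(2,3,5) assms(1) by auto
  have q_le: "q \<le> n" using F(2,4) by simp
  have m: "m > 0" using q q_le assms(7) by (simp add: div_greater_zero_iff)
  \<comment> \<open>Like \<open>s\<close> above, \<open>m * q\<close> exceeds n/2: the remainder
    \<open>n mod q\<close> is smaller than \<open>q\<close>, which is at most \<open>m * q\<close>.
    The bound 3 for both is what yields \<open>A + B < pi\<close>.\<close>
  have mq3: "m * q \<ge> 3"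
  proof -
    have "n = m * q + n mod q" "n mod q < q" "q \<le> m * q"
      using assms(7) q m by simp_all
    then show ?thesis using assms(1) by linarith
  qed
  have det: "real q * real r = real p * real s + 1"
    using F(1) by (simp flip: of_nat_mult)
  have \<phi>1: "2 * pi * p < \<phi> * q" and \<phi>2: "\<phi> * s < 2 * pi * r"
    using assms(14,15) q s by (simp_all add: field_simps)
  have A0: "A > 0" and B0: "B > 0"
    using \<phi>1 \<phi>2 m assms(16,17) by (simp_all add: angle_A_def angle_B_def mult.commute)
  have mB: "m * B = 2 * pi * r - s * \<phi>" and Adef: "A = q * \<phi> - 2 * pi * p"
    using m assms(16,17) by (simp_all add: angle_A_def angle_B_def)
  \<comment> \<open>This combination eliminates the angle and leaves 2 pi times the Farey
    determinant.\<close>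
  have comb: "s * A + (m * q) * B = 2 * pi"
  proof -
    have "s * A + (m * q) * B = s * A + q * (m * B)" by simp
    also have "\<dots> = 2 * pi * (real q * real r - real p * real s)"
      unfolding mB Adef by (simp add: algebra_simps)
    finally show ?thesis using det by simp
  qed
  have AB: "A + B < pi"
  proof -
    have "3 * A \<le> s * A" using s3 A0 by (intro mult_right_mono) auto
    moreover have "3 * B \<le> (m * q) * B"
      using mq3 B0 by (intro mult_right_mono) (auto simp flip: of_nat_mult)
    ultimately show ?thesis using comb pi_gt_zero by linarith
  qed
  have Api: "A < pi" and Bpi: "B < pi" using AB A0 B0 by auto
  define x where "x = \<rho> ^ q"
  have x: "x > 0" using assms(10) by (simp add: x_def)
  define z where "z = complex_of_real x * cis A"
  have \<omega>q: "\<omega> ^ q = z"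
  proof -
    have "cis (q * \<phi>) = cis A"
      using cis_multiple_2pi[of "real p"] unfolding Adef by (simp add: cis_divide [symmetric])
    then show ?thesis
      unfolding z_def x_def assms(12) by (simp add: power_mult_distrib cis_conv_exp [symmetric] Complex.DeMoivre)
  qed
  have u_eq: "u j = Arg (complex_of_real x * cis A - complex_of_real (\<beta> j))" if "j < m" for j
    using assms(20) that \<omega>q z_def by simp
  note U = Arg_shift[OF x A0 Api u_eq]
  \<comment> \<open>Writing 1 as \<open>complex_of_real 1\<close> makes \<open>M\<close> the
    instance \<open>b = 1\<close> of \<open>Arg_shift\<close>.\<close>
  have M_eq: "M = Arg (complex_of_real x * cis A - complex_of_real 1)"
    using assms(19) \<omega>q z_def by simp
  note MM = Arg_shift[OF x A0 Api M_eq]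
  define N where "N = cmod (z - 1)"
  have N0: "N > 0"
  proof -
    have "N * sin M = x * sin A" using MM(4) by (simp add: N_def z_def)
    moreover have "x * sin A > 0" using x A0 Api by (simp add: sin_gt_zero)
    ultimately show ?thesis
      using MM(1,2) sin_gt_zero[of M] by (metis zero_less_mult_pos2)
  qed
  have one: "sin v - x * sin (v - A) = N * sin (M - v)" for v
    using Arg_shift_one[OF x A0 Api, of M v] M_eq by (simp add: N_def z_def)
  have su: "sin (u j) > 0" if "j < m" for j using U(1,2)[OF that] sin_gt_zero by blast
  have oneb: "(1 - \<beta> j) * sin (u j) = N * sin (M - u j)" if "j < m" for j
    using one[of "u j"] U(3)[OF that] by (simp add: algebra_simps)
  \<comment> \<open>A sign comparison in \<open>oneb\<close>: its left side is positive because
    beta_j < 1. The lower bound \<open>Au\<close> uses beta_j >= 0 in the same way.\<close>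
  have uM: "u j < M" if j: "j < m" for j
  proof (rule ccontr)
    assume "\<not> u j < M"
    then have "sin (u j - M) \<ge> 0" using U(1,2)[OF j] MM(1,2) by (intro sin_ge_zero) auto
    then have "sin (M - u j) \<le> 0" by (metis minus_diff_eq neg_le_0_iff_le sin_minus)
    then have "N * sin (M - u j) \<le> 0" using N0 by (simp add: mult_le_0_iff)
    moreover have "(1 - \<beta> j) * sin (u j) > 0" using su[OF j] assms(9) j by simp
    ultimately show False using oneb[OF j] by simp
  qed
  have Au: "A \<le> u j" if j: "j < m" for j
  proof (rule ccontr)
    assume "\<not> A \<le> u j"
    then have "sin (A - u j) > 0" using U(1,2)[OF j] Api by (intro sin_gt_zero) auto
    then have "sin (u j - A) < 0" by (metis minus_diff_eq neg_less_0_iff_less sin_minus)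
    then have "x * sin (u j - A) < 0" using x by (simp add: mult_less_0_iff)
    moreover have "\<beta> j * sin (u j) \<ge> 0" using su[OF j] assms(9) j by simp
    ultimately show False using U(3)[OF j] by simp
  qed
  define v where "v = A + B"
  have sv: "sin v > 0" using A0 B0 AB by (simp add: v_def sin_gt_zero)
  \<comment> \<open>The angle hypothesis, taken as an equality of reals and not modulo 2 pi, says
    that the u_j have mean \<open>v\<close>.\<close>
  have sum_u: "(\<Sum>j<m. u j) = m * v"
  proof -
    have "(\<Sum>j<m. u j) = m * A + m * B"
      using assms(21) unfolding mB Adef by (simp add: algebra_simps)
    then show ?thesis by (simp add: v_def algebra_simps)
  qed
  have vM: "v < M"
  proof -
    have "(\<Sum>j<m. u j) < (\<Sum>j<m. M)" using uM m by (intro sum_strict_mono) auto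
    then show ?thesis using sum_u m by simp
  qed
  have sum_d: "(\<Sum>j<m. M - u j) = real (card {..<m}) * (M - v)"
    by (simp add: sum_subtractf sum_u algebra_simps)
  have rng: "0 < M - u j \<and> M - u j < pi" if "j \<in> {..<m}" for j
    using that uM U(1) MM(2) by (metis add.commute add_strict_increasing2 diff_gt_0_iff_gt diff_less_eq lessThan_iff less_imp_le)
  have rngv: "0 < M - v" "M - v < pi" using vM MM(2) A0 B0 by (auto simp: v_def)
  note jensen = prod_sin_le[OF finite_lessThan rng rngv sum_d]
  define T where "T = \<rho> powr (real s / real m) * sin A"
  have sA: "sin A > 0" using A0 Api sin_gt_zero by blast
  have T0: "T > 0" using assms(10) sA by (simp add: T_def)
  have Tm: "T ^ m = N ^ m * (\<Prod>j<m. sin (M - u j))"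
  proof -
    have "\<omega> ^ (n0 - m * q) * (\<Prod>j<m. (z - complex_of_real (\<beta> j)))
      = \<omega> ^ (n0 - s) * (\<Prod>j<m. complex_of_real (1 - \<beta> j))"
      using assms(13) unfolding poly_ito_poly \<omega>q by simp
    then have "cmod \<dots> = cmod (\<omega> ^ (n0 - m * q) * (\<Prod>j<m. (z - complex_of_real (\<beta> j))))" by simp
    moreover have "cmod \<omega> = \<rho>" using assms(10,12) by (simp add: norm_mult)
    moreover have "cmod (complex_of_real (1 - \<beta> j)) = 1 - \<beta> j" if "j < m" for j
      using assms(9) that by (simp only: norm_of_real) auto
    ultimately have norms: "\<rho> ^ (n0 - s) * (\<Prod>j<m. 1 - \<beta> j) =
      \<rho> ^ (n0 - m * q) * (\<Prod>j<m. cmod (z - complex_of_real (\<beta> j)))"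
      by (simp add: norm_mult norm_power prod_norm [symmetric] del: of_real_diff)
    \<comment> \<open>Multiplying the modulus equation by all \<open>sin (u j)\<close> lets the two
      sine laws replace every factor that contains a beta_j.\<close>
    have "\<rho> ^ (n0 - s) * (N ^ m * (\<Prod>j<m. sin (M - u j)))
      = \<rho> ^ (n0 - s) * (\<Prod>j<m. (1 - \<beta> j) * sin (u j))"
      using oneb by (simp add: prod.distrib)
    also have "\<dots> = (\<rho> ^ (n0 - s) * (\<Prod>j<m. 1 - \<beta> j)) * (\<Prod>j<m. sin (u j))"
      by (simp add: prod.distrib)
    also have "\<dots> = \<rho> ^ (n0 - m * q) * (\<Prod>j<m. cmod (z - complex_of_real (\<beta> j)) * sin (u j))"
      unfolding norms by (simp add: prod.distrib)
    also have "(\<Prod>j<m. cmod (z - complex_of_real (\<beta> j)) * sin (u j)) = (x * sin A) ^ m"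
      using U(4) by (simp add: z_def)
    also have "\<rho> ^ (n0 - m * q) * (x * sin A) ^ m = \<rho> ^ (n0 - m * q + q * m) * sin A ^ m"
      by (simp add: x_def power_mult_distrib power_add power_mult)
    \<comment> \<open>Both subtractions are exact because \<open>n0\<close> is the maximum of
      \<open>m * q\<close> and \<open>s\<close>.\<close>
    also have "n0 - m * q + q * m = (n0 - s) + s" using assms(8) by (simp add: mult.commute)
    also have "\<rho> ^ \<dots> * sin A ^ m = \<rho> ^ (n0 - s) * (\<rho> ^ s * sin A ^ m)"
      by (simp add: power_add)
    finally have "N ^ m * (\<Prod>j<m. sin (M - u j)) = \<rho> ^ s * sin A ^ m"
      using assms(10) by simp
    moreover have "(\<rho> powr (real s / real m)) ^ m = \<rho> ^ s"
    proof -
      have "(\<rho> powr (real s / real m)) ^ m = (\<rho> powr (real s / real m)) powr real m"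
        using assms(10) by (simp add: powr_realpow)
      then show ?thesis using m assms(10) by (simp add: powr_powr powr_realpow)
    qed
    ultimately show ?thesis by (simp add: T_def power_mult_distrib)
  qed
  define e where "e = real s / real m"
  have e: "e > 0" using s m by (simp add: e_def)
  define S where "S = N * sin (M - v)"
  have S0: "S > 0" using N0 rngv by (simp add: S_def sin_gt_zero)
  \<comment> \<open>Since \<open>v - A = B\<close>, the inequality \<open>T \<le> S\<close> proved
    next says that \<open>karp_fun\<close> at rho is at most \<open>sin (A + B)\<close>, its value
    at K_n(theta).\<close>
  have S: "S = sin (A + B) - x * sin B" using one[of v] by (simp add: S_def v_def)
  have "T ^ m \<le> S ^ m"
    using jensen(1) N0 unfolding Tm S_def by (simp add: power_mult_distrib mult_left_mono)
  then have TS: "T \<le> S" using S0 m by (metis less_imp_le power_mono_iff T0)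
  have "T = S \<longleftrightarrow> T ^ m = S ^ m"
    using T0 S0 m by (metis less_imp_le power_eq_imp_eq_base)
  also have "\<dots> \<longleftrightarrow> (\<Prod>j<m. sin (M - u j)) = sin (M - v) ^ m"
    unfolding Tm S_def using N0 by (simp add: power_mult_distrib)
  also have "\<dots> \<longleftrightarrow> (\<forall>j<m. u j = v)" using jensen(2) by auto
  finally have TS_eq: "T = S \<longleftrightarrow> (\<forall>j<m. u j = v)" .
  have \<beta>v: "\<beta> j = x * sin B / sin (A + B)" if "j < m" "u j = v" for j
    using U(3)[OF that(1)] that(2) sv by (simp add: v_def field_simps)
  have const: "(\<forall>j<m. u j = v) \<longleftrightarrow> (\<forall>i<m. \<forall>j<m. \<beta> i = \<beta> j)"
  proof
    assume "\<forall>j<m. u j = v"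
    then show "\<forall>i<m. \<forall>j<m. \<beta> i = \<beta> j" using \<beta>v by metis
  next
    assume eq: "\<forall>i<m. \<forall>j<m. \<beta> i = \<beta> j"
    show "\<forall>j<m. u j = v"
    proof (intro allI impI)
      fix j assume j: "j < m"
      \<comment> \<open>Equal parameters give equal arguments, and equal arguments coincide with
        their mean \<open>v\<close>.\<close>
      have "(\<Sum>i<m. u i) = (\<Sum>i<m. u j)"
      proof (rule sum.cong)
        fix i assume "i \<in> {..<m}"
        then have i: "i < m" by simp
        then have "\<beta> i = \<beta> j" using eq j by blast
        then show "u i = u j" using assms(20) i j by simp
      qed simp
      then show "u j = v" using sum_u m by simp
    qed
  qed
  have kf: "karp_fun e q A B \<rho> = T + x * sin B" by (simp add: karp_fun_def T_def x_def e_def)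
  define K where "K = karp_radius n \<theta>"
  \<comment> \<open>As \<open>g\<close> is at most 1/2, the angle lies below pi in the unreflected
    case and above pi in the reflected one, so the minimum defining \<open>\<theta>\<close> selects
    the branch that \<open>karp_radius\<close> expects.\<close>
  have \<theta>_cases: "(\<phi> = (if denom f < denom g then \<theta> else 2 * pi - \<theta>)) \<and>
    of_rat f < \<theta> / (2 * pi) \<and> \<theta> / (2 * pi) < of_rat g"
  proof -
    have g2: "(of_rat g :: real) \<le> 1 / 2"
      using farey_half_bounds(3)[OF fg] by (metis of_rat_1 of_rat_divide of_rat_less_eq of_rat_numeral_eq)
    have lo: "of_rat (lower_frac f g) < \<phi> / (2 * pi)" and up: "\<phi> / (2 * pi) < of_rat (upper_frac f g)"
      using assms(14,15) F(6,7) by simp_all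
    show ?thesis
    proof (cases "denom f < denom g")
      case True
      then have b: "of_rat f < \<phi> / (2 * pi)" "\<phi> / (2 * pi) < of_rat g"
        using lo up by (simp_all add: lower_frac_def upper_frac_def)
      then have "\<phi> / (2 * pi) < 1 / 2" using g2 by linarith
      then have "\<phi> < pi" by (simp add: field_simps)
      then have "\<theta> = \<phi>" using assms(18) by simp
      then show ?thesis using True b by simp
    next
      case False
      then have b: "1 - of_rat g < \<phi> / (2 * pi)" "\<phi> / (2 * pi) < 1 - of_rat f"
        using lo up by (simp_all add: lower_frac_def upper_frac_def of_rat_diff)
      then have "1 / 2 < \<phi> / (2 * pi)" using g2 by linarith
      then have "pi < \<phi>" by (simp add: field_simps)
      then have \<theta>: "\<theta> = 2 * pi - \<phi>" using assms(18) by simp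
      then have "\<theta> / (2 * pi) = 1 - \<phi> / (2 * pi)" by (simp add: field_simps)
      then show ?thesis using False b \<theta> by simp
    qed
  qed
  have K: "0 < K \<and> K < 1 \<and> karp_fun e q A B K = sin (A + B)"
    using theI'[OF karp_fun_ex1[OF e q A0 B0 AB]]
      karp_radius_eq[OF fg conjunct1[OF conjunct2[OF \<theta>_cases]] conjunct2[OF conjunct2[OF \<theta>_cases]]
        assms(3-7) conjunct1[OF \<theta>_cases] assms(16,17)]
    by (simp add: K_def e_def)
  have mono: "karp_fun e q A B R < karp_fun e q A B R'" if "0 < R" "R < R'" for R R'
    using karp_fun_strict_mono[OF e A0 Api B0 Bpi that] .
  have "karp_fun e q A B \<rho> \<le> karp_fun e q A B K" using kf K TS S by simp
  then have \<rho>K: "\<rho> \<le> K" using mono[of K \<rho>] K by (meson leD leI)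
  \<comment> \<open>Strict monotonicity turns equality of radii into equality of values, that is
    into \<open>T = S\<close>, the equality case of Jensen.\<close>
  have "\<rho> = K \<longleftrightarrow> karp_fun e q A B \<rho> = karp_fun e q A B K"
    using mono[of \<rho> K] assms(10) \<rho>K by (cases "\<rho> = K") auto
  also have "\<dots> \<longleftrightarrow> T = S" using kf K S by auto
  finally have \<rho>K_eq: "\<rho> = K \<longleftrightarrow> (\<forall>i<m. \<forall>j<m. \<beta> i = \<beta> j)"
    using TS_eq const by simp
  have "\<beta> j = K ^ q * sin B / sin (A + B)" if "\<forall>i<m. \<forall>j<m. \<beta> i = \<beta> j" "j < m" for j
  proof -
    have "u j = v" "\<rho> = K" using const \<rho>K_eq that by blast+
    then show ?thesis using \<beta>v[OF that(2)] by (simp add: x_def)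
  qed
  moreover have "real p / real q < real r / real s" using assms(14,15) by linarith
  ultimately show ?thesis
    using qs MM(1,2) U(1,2) Au uM \<rho>K \<rho>K_eq unfolding K_def by blast
qed

end
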